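(* Let $G$ be a locally compact second countable group with modular function $\Delta_G : G \to \mathbb{R}_+$, and suppose that $\Delta_G(G) = \mathbb{R}_+$. Then for every countable dense subgroup $\Gamma$ of $G$, the left translation action $\Gamma \curvearrowright G$, where $G$ is equipped with its left Haar measure, is not strongly ergodic.
   Context: $\mathbb{R}_+ = (0,\infty)$ is the multiplicative group of positive reals. A non-singular countable Borel equivalence relation $\mathcal{R}$ on a standard probability space $(X,\mu)$ has full group $[\mathcal{R}]$, the group of (non-singular) Borel automorphisms $g$ of $X$ with $(gx,x)\in\mathcal{R}$ for almost every $x$. An almost invariant sequence for $\mathcal{R}$ is a sequence of measurable sets $A_n\subset X$ with $\mu(A_n \,\Delta\, gA_n)\to 0$ for all $g\in[\mathcal{R}]$; it is trivial if $\mu(A_n)(1-\mu(A_n))\to 0$. $\mathcal{R}$ is strongly ergodic if it has no non-trivial almost invariant sequence. A non-singular action of a countable group is strongly ergodic if its orbit equivalence relation is. For the action on $G$ with its (possibly infinite) left Haar measure $m_G$, strong ergodicity is understood with respect to a probability measure $\mu_G$ on $G$ equivalent to $m_G$ (it depends only on the measure class). *)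

theory Defs
  imports "HOL-Probability.Probability"
begin

text \<open>
  Groups are written additively, following the library classes \<^class>\<open>group_add\<close> and
  \<^class>\<open>topological_group_add\<close>. These classes do not assume commutativity, so left
  translation \<open>x \<mapsto> g + x\<close> and right translation \<open>x \<mapsto> x + g\<close> have to be distinguished.
\<close>

definition add_subgroup :: "'a::group_add set \<Rightarrow> bool" where
  "add_subgroup H \<longleftrightarrow> 0 \<in> H \<and> (\<forall>x\<in>H. \<forall>y\<in>H. x + y \<in> H) \<and> (\<forall>x\<in>H. - x \<in> H)"

text \<open>
  Regularity is not required below: on a second countable locally compact Hausdorff space
  every Borel measure that is finite on compact sets is regular.
\<close>

definition left_haar_measure :: "'a::topological_group_add measure \<Rightarrow> bool" where
  "left_haar_measure m \<longleftrightarrow>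
     sets m = sets borel \<and>
     emeasure m UNIV \<noteq> 0 \<and>
     (\<forall>K. compact K \<longrightarrow> emeasure m K < \<infinity>) \<and>
     (\<forall>g. \<forall>A\<in>sets borel. emeasure m ((\<lambda>x. g + x) ` A) = emeasure m A)"

text \<open>
  For a left Haar measure \<open>m\<close>, the measure \<open>A \<mapsto> m (A + g)\<close> is again a left Haar measure,
  hence a unique positive multiple of \<open>m\<close>; the modular function is this multiple. (The other
  common convention yields the reciprocal function.)
\<close>

definition modular_function :: "'a::topological_group_add measure \<Rightarrow> 'a \<Rightarrow> real" where
  "modular_function m g =
     (THE c. 0 < c \<and>
        (\<forall>A\<in>sets borel. emeasure m ((\<lambda>x. x + g) ` A) = ennreal c * emeasure m A))"

definition full_group :: "'a measure \<Rightarrow> ('a \<times> 'a) set \<Rightarrow> ('a \<Rightarrow> 'a) set" where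
  "full_group M R = {g.
     bij_betw g (space M) (space M) \<and>
     g \<in> measurable M M \<and>
     the_inv_into (space M) g \<in> measurable M M \<and>
     (\<forall>A\<in>sets M. g ` A \<in> null_sets M \<longleftrightarrow> A \<in> null_sets M) \<and>
     (AE x in M. (g x, x) \<in> R)}"

definition almost_invariant_seq :: "'a measure \<Rightarrow> ('a \<times> 'a) set \<Rightarrow> (nat \<Rightarrow> 'a set) \<Rightarrow> bool" where
  "almost_invariant_seq M R A \<longleftrightarrow>
     (\<forall>n. A n \<in> sets M) \<and>
     (\<forall>g\<in>full_group M R. (\<lambda>n. measure M (sym_diff (A n) (g ` A n))) \<longlonglongrightarrow> 0)"

definition trivial_seq :: "'a measure \<Rightarrow> (nat \<Rightarrow> 'a set) \<Rightarrow> bool" where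
  "trivial_seq M A \<longleftrightarrow> (\<lambda>n. measure M (A n) * (1 - measure M (A n))) \<longlonglongrightarrow> 0"

definition strongly_ergodic :: "'a measure \<Rightarrow> ('a \<times> 'a) set \<Rightarrow> bool" where
  "strongly_ergodic M R \<longleftrightarrow> (\<forall>A. almost_invariant_seq M R A \<longrightarrow> trivial_seq M A)"

definition orbit_rel :: "'g set \<Rightarrow> ('g \<Rightarrow> 'a \<Rightarrow> 'a) \<Rightarrow> ('a \<times> 'a) set" where
  "orbit_rel \<Gamma> act = {(x, y). \<exists>g\<in>\<Gamma>. x = act g y}"

definition equivalent_measures :: "'a measure \<Rightarrow> 'a measure \<Rightarrow> bool" where
  "equivalent_measures M N \<longleftrightarrow>
     sets M = sets N \<and> absolutely_continuous M N \<and> absolutely_continuous N M"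

text \<open>
  Strong ergodicity with respect to a possibly infinite (nonzero, sigma-finite) measure \<open>m\<close>
  refers to a probability measure equivalent to \<open>m\<close>. Such a measure exists, and the property
  does not depend on its choice; in particular, the negation of the property below asserts
  failure of strong ergodicity for every such probability measure.
\<close>

definition strongly_ergodic_action ::
    "'g set \<Rightarrow> ('g \<Rightarrow> 'a \<Rightarrow> 'a) \<Rightarrow> 'a measure \<Rightarrow> bool" where
  "strongly_ergodic_action \<Gamma> act m \<longleftrightarrow>
     (\<exists>\<mu>. prob_space \<mu> \<and> equivalent_measures \<mu> m \<and> strongly_ergodic \<mu> (orbit_rel \<Gamma> act))"

end

theory Submission
  imports Defs
begin

text \<open>
  The logarithm \<open>\<phi>\<close> of the modular function is a Borel homomorphism onto the reals, and by Fubini the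
  preimages of Lebesgue null sets are null. Simultaneous Dirichlet approximation yields frequencies
  \<open>k\<^sub>n \<ge> 1\<close> such that, for every \<open>\<gamma> \<in> \<Gamma>\<close>, the distance from \<open>k\<^sub>n \<phi>(\<gamma>)\<close> to the integers decays
  exponentially. Put \<open>A\<^sub>n = {sin (2 \<pi> (k\<^sub>n \<phi> + s\<^sub>n)) > 0}\<close>, with the phase \<open>s\<^sub>n\<close> chosen by the
  intermediate value theorem such that \<open>A\<^sub>n\<close> has measure 1/2. If \<open>A\<^sub>n\<close> separates \<open>x\<close> from \<open>\<gamma> + x\<close>, then
  \<open>\<phi>(x)\<close> is exponentially close to a zero of the sine wave; by Borel-Cantelli this happens for almost
  every \<open>x\<close> only finitely often. This gives almost invariance under the whole full group at once.
\<close>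


section \<open>Null sets of a left Haar measure under inversion and translation\<close>

lemma borel_measurable_uminus_group [measurable (raw)]:
  fixes f :: "'b \<Rightarrow> 'a::{second_countable_topology, topological_group_add}"
  assumes "f \<in> borel_measurable M"
  shows "(\<lambda>x. - f x) \<in> borel_measurable M"
  by (rule borel_measurable_continuous_on[OF _ assms]) (intro continuous_intros)

text \<open>Supplies a test set whose measure can be cancelled when proportionality constants are
  compared.\<close>

lemma (in sigma_finite_measure) obtain_finite_pos:
  assumes "emeasure M (space M) \<noteq> 0"
  obtains A where "A \<in> sets M" "emeasure M A \<noteq> 0" "emeasure M A \<noteq> \<infinity>"
proof -
  obtain A :: "nat \<Rightarrow> 'a set" where A: "range A \<subseteq> sets M" "(\<Union>i. A i) = space M" "\<And>i. emeasure M (A i) \<noteq> \<infinity>"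
    using sigma_finite by blast
  have "\<exists>i. emeasure M (A i) \<noteq> 0"
  proof (rule ccontr)
    assume "\<nexists>i. emeasure M (A i) \<noteq> 0"
    then have "(\<Union>i. A i) \<in> null_sets M"
      using A(1) by (intro null_sets_UN) (auto simp: null_sets_def)
    then show False using A(2) assms by auto
  qed
  then show ?thesis using A that by blast
qed

text \<open>Sigma-finiteness is what Fubini and Radon-Nikodym require;
  \<open>left_haar_measure_sigma_finite\<close> derives it from local compactness.\<close>

locale sigma_finite_left_haar = sigma_finite_measure m
  for m :: "'a::{topological_group_add, t2_space, second_countable_topology} measure" +
  assumes haar: "left_haar_measure m"
begin

lemma sets_m [simp, measurable_cong]: "sets m = sets borel"
  using haar by (simp add: left_haar_measure_def)

lemma space_m [simp]: "space m = UNIV"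
  using sets_eq_imp_space_eq[OF sets_m] by simp

lemma emeasure_UNIV_nonzero: "emeasure m UNIV \<noteq> 0"
  using haar by (simp add: left_haar_measure_def)

lemma ae_filter_nonbot: "ae_filter m \<noteq> bot"
  using emeasure_UNIV_nonzero by (simp add: ae_filter_eq_bot_iff)

text \<open>Invariance is defined through images, whereas measurability and \<open>distr\<close>
  work with preimages; this identity and the next one translate between the two.\<close>

lemma vimage_eq_image: "(\<lambda>x. g + x) -` A = (\<lambda>x. - g + x) ` A" for g :: 'a
  by (force simp: add.assoc[symmetric] image_iff)

lemma image_right_eq_vimage: "(\<lambda>x. x + g) ` A = (\<lambda>x. x - g) -` A" for g :: 'a
  by (force simp: image_iff)

lemma emeasure_left_translate:
  assumes "A \<in> sets borel"
  shows "emeasure m ((\<lambda>x. g + x) -` A) = emeasure m A"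
  using haar assms unfolding vimage_eq_image left_haar_measure_def by blast

lemma left_translate_sets: "A \<in> sets borel \<Longrightarrow> (\<lambda>x. g + x) -` A \<in> sets borel" for g :: 'a
  using measurable_sets[of "\<lambda>x. g + x" borel borel A] by simp

lemma right_translate_sets: "A \<in> sets borel \<Longrightarrow> (\<lambda>x. x + g) -` A \<in> sets borel" for g :: 'a
  using measurable_sets[of "\<lambda>x. x + g" borel borel A] by simp

lemma uminus_sets: "A \<in> sets borel \<Longrightarrow> uminus -` A \<in> sets (borel :: 'a measure)"
  using measurable_sets[of "uminus" borel borel A] by simp

lemma distr_left_translate: "distr m m (\<lambda>x. g + x) = m"
  by (rule measure_eqI) (auto simp: emeasure_distr emeasure_left_translate)

lemma null_left_translate: "N \<in> null_sets m \<Longrightarrow> (\<lambda>x. g + x) -` N \<in> null_sets m"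
  by (auto simp: null_sets_def emeasure_left_translate left_translate_sets)

text \<open>Fubini for the set of pairs \<open>(y, x)\<close> with \<open>- y + x \<in> N\<close>:
  by left invariance the section at every \<open>y\<close> is null, so the section at some
  \<open>x\<close> is null too. As \<open>- y + x = - (- x + y)\<close>, the latter is a left
  translate of the inverse of \<open>N\<close>.\<close>

lemma null_uminus:
  assumes "N \<in> null_sets m"
  shows "uminus -` N \<in> null_sets m"
proof -
  interpret P: pair_sigma_finite m m ..
  have [measurable]: "N \<in> sets borel" using assms by (auto simp: null_sets_def)
  have "AE x in m. - y + x \<notin> N" for y
    using AE_not_in[OF null_left_translate[OF assms, of "- y"]] by simp
  then have "AE y in m. AE x in m. - y + x \<notin> N" by simp
  then have "AE x in m. AE y in m. - y + x \<notin> N"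
    by (subst (asm) P.AE_commute) measurable
  then obtain x where x: "AE y in m. - y + x \<notin> N"
    using eventually_happens'[OF ae_filter_nonbot] by blast
  have eq: "{y \<in> space m. - y + x \<in> N} = (\<lambda>y. - x + y) -` (uminus -` N)"
    by (auto simp: minus_add)
  have "(\<lambda>y. - x + y) -` (uminus -` N) \<in> null_sets m"
    using x unfolding eq[symmetric] by (subst (asm) AE_iff_null) (simp_all, measurable)
  then show ?thesis
    using uminus_sets[of N] by (auto simp: null_sets_def emeasure_left_translate)
qed

text \<open>Inversion conjugates right translations into left translations.\<close>

lemma null_right_translate:
  assumes "N \<in> null_sets m"
  shows "(\<lambda>x. x + g) -` N \<in> null_sets m"
proof -
  have "(\<lambda>x. x + g) -` N = uminus -` ((\<lambda>x. - g + x) -` (uminus -` N))"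
    by (auto simp: minus_add)
  then show ?thesis
    using null_uminus[OF null_left_translate[OF null_uminus[OF assms]]] by simp
qed

text \<open>Right translates of \<open>m\<close> are absolutely continuous with respect to \<open>m\<close>, and left invariance
  forces their Radon-Nikodym density to be constant.\<close>

lemma right_translate_proportional:
  "\<exists>c>0. \<forall>A\<in>sets borel. emeasure m ((\<lambda>x. x + g) ` A) = ennreal c * emeasure m A"
proof -
  \<comment> \<open>\<open>n\<close> is the right translate \<open>A \<mapsto> m (A + g)\<close>,
    written as an image measure.\<close>
  define n where "n = distr m m (\<lambda>x. x - g)"
  have [measurable]: "(\<lambda>x. x - g) \<in> borel_measurable borel"
    using borel_measurable_add[of "\<lambda>x. x" borel "\<lambda>_. - g"] by simp
  have n: "emeasure n A = emeasure m ((\<lambda>x. x - g) -` A)" if "A \<in> sets borel" for A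
    using that by (simp add: n_def emeasure_distr)
  have "absolutely_continuous m n"
    unfolding absolutely_continuous_def
  proof
    fix N assume N: "N \<in> null_sets m"
    then have "(\<lambda>x. x - g) -` N \<in> null_sets m"
      using null_right_translate[of N "- g"] by simp
    then show "N \<in> null_sets n"
      using N by (auto simp: null_sets_def n) (simp add: n_def)
  qed
  then obtain f where f [measurable]: "f \<in> borel_measurable m" and fn: "density m f = n"
    using Radon_Nikodym[of n] by (auto simp: n_def)
  \<comment> \<open>Left and right translations commute, so \<open>n\<close> is left invariant like
    \<open>m\<close>. Hence \<open>f\<close> and its left translate are densities of the same
    measure and agree almost everywhere.\<close>
  have inv: "AE x in m. f (h + x) = f x" for h
  proof -
    have "density m (\<lambda>x. f (h + x)) = n"
    proof (rule measure_eqI)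
      fix A assume "A \<in> sets (density m (\<lambda>x. f (h + x)))"
      then have A [measurable]: "A \<in> sets borel" by simp
      have hA: "(\<lambda>y. - h + y) -` A \<in> sets borel" by (rule left_translate_sets[OF A])
      have "emeasure (density m (\<lambda>x. f (h + x))) A
          = (\<integral>\<^sup>+x. f (h + x) * indicator ((\<lambda>y. - h + y) -` A) (h + x) \<partial>m)"
        by (subst emeasure_density) (auto simp: indicator_def add.assoc[symmetric] intro!: nn_integral_cong)
      also have "\<dots> = (\<integral>\<^sup>+y. f y * indicator ((\<lambda>y. - h + y) -` A) y \<partial>distr m m (\<lambda>x. h + x))"
        using hA by (subst nn_integral_distr) auto
      also have "\<dots> = emeasure n ((\<lambda>y. - h + y) -` A)"
        using hA unfolding distr_left_translate fn[symmetric] by (simp add: emeasure_density)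
      also have "\<dots> = emeasure m ((\<lambda>x. x - g) -` ((\<lambda>y. - h + y) -` A))"
        using n hA by simp
      also have "(\<lambda>x. x - g) -` ((\<lambda>y. - h + y) -` A) = (\<lambda>y. - h + y) -` ((\<lambda>x. x - g) -` A)"
        by (auto simp: diff_conv_add_uminus add.assoc simp del: add_uminus_conv_diff)
      also have "emeasure m \<dots> = emeasure n A"
        using n[OF A] measurable_sets_borel[OF _ A, of "\<lambda>x. x - g"]
        by (simp add: emeasure_left_translate)
      finally show "emeasure (density m (\<lambda>x. f (h + x))) A = emeasure n A" .
    qed (simp add: n_def)
    then show ?thesis
      using density_unique_iff[of "\<lambda>x. f (h + x)" f] fn by simp
  qed
  interpret P: pair_sigma_finite m m ..
  \<comment> \<open>The null set in \<open>inv\<close> depends on \<open>h\<close>. Fubini yields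
    one base point \<open>x0\<close> that works for almost all \<open>h\<close>; right translation
    by \<open>- x0\<close> preserves null sets and turns this into \<open>f\<close> being almost
    everywhere constant.\<close>
  have "AE h in m. AE x in m. f (h + x) = f x" using inv by simp
  then have "AE x in m. AE h in m. f (h + x) = f x"
    by (subst (asm) P.AE_commute) measurable
  then obtain x0 where x0: "AE h in m. f (h + x0) = f x0"
    using eventually_happens'[OF ae_filter_nonbot] by blast
  have "{h. f (h + x0) \<noteq> f x0} \<in> null_sets m"
    using x0 by (subst (asm) AE_iff_null) (simp_all, measurable)
  from null_right_translate[OF this, of "- x0"] have "{y. f y \<noteq> f x0} \<in> null_sets m"
    by (simp add: vimage_def)
  then have "AE y in m. f y = f x0" by (rule AE_I') auto
  then have "density m f = density m (\<lambda>_. f x0)" by (intro density_cong) auto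
  then have nm: "emeasure n A = f x0 * emeasure m A" if "A \<in> sets borel" for A
    using that by (simp add: fn emeasure_density nn_integral_cmult_indicator)
  obtain A where A: "A \<in> sets borel" "emeasure m A \<noteq> 0" "emeasure m A \<noteq> \<infinity>"
    using obtain_finite_pos emeasure_UNIV_nonzero by auto
  \<comment> \<open>The translate of \<open>A\<close> by \<open>- g\<close> has
    \<open>n\<close>-measure \<open>emeasure m A\<close>, which is positive and finite; this
    excludes the values 0 and infinity for the constant.\<close>
  have Ag: "(\<lambda>x. x + g) -` A \<in> sets borel" by (rule right_translate_sets[OF A(1)])
  have "(\<lambda>x. x - g) -` ((\<lambda>x. x + g) -` A) = A" by auto
  then have eq: "f x0 * emeasure m ((\<lambda>x. x + g) -` A) = emeasure m A"
    using n[OF Ag] nm[OF Ag] by simp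
  then have "f x0 \<noteq> 0" "f x0 \<noteq> \<infinity>"
    using A by (auto simp: ennreal_top_mult split: if_splits)
  then obtain c where "f x0 = ennreal c" "0 < c"
    by (cases "f x0") (auto simp: le_less)
  then show ?thesis
    using n nm by (auto simp: image_right_eq_vimage intro!: exI[of _ c])
qed

section \<open>The modular function as a measurable homomorphism\<close>

text \<open>The definite description denotes: existence is
  \<open>right_translate_proportional\<close>, and uniqueness follows by cancelling a positive
  finite measure.\<close>

lemma modular_function:
  shows modular_function_pos: "0 < modular_function m g"
    and emeasure_right_translate: "A \<in> sets borel \<Longrightarrow>
      emeasure m ((\<lambda>x. x + g) ` A) = ennreal (modular_function m g) * emeasure m A"
proof -
  let ?P = "\<lambda>c. 0 < c \<and> (\<forall>A\<in>sets borel. emeasure m ((\<lambda>x. x + g) ` A) = ennreal c * emeasure m A)"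
  obtain A where A: "A \<in> sets borel" "emeasure m A \<noteq> 0" "emeasure m A \<noteq> \<infinity>"
    using obtain_finite_pos emeasure_UNIV_nonzero by auto
  have "\<exists>!c. ?P c"
  proof (rule ex_ex1I)
    fix c d assume c: "?P c" and d: "?P d"
    then have "ennreal c * emeasure m A = ennreal d * emeasure m A" using A(1) by metis
    then have "ennreal c = ennreal d"
      using A by (auto simp: mult.commute[of _ "emeasure m A"] ennreal_mult_cancel_left)
    then show "c = d" using c d by simp
  qed (use right_translate_proportional in blast)
  from theI'[OF this] have "?P (modular_function m g)"
    unfolding modular_function_def .
  then show "0 < modular_function m g"
    "A \<in> sets borel \<Longrightarrow>
      emeasure m ((\<lambda>x. x + g) ` A) = ennreal (modular_function m g) * emeasure m A" for A
    by auto
qed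

lemma modular_function_add:
  "modular_function m (g + h) = modular_function m g * modular_function m h"
proof -
  obtain A where A: "A \<in> sets borel" "emeasure m A \<noteq> 0" "emeasure m A \<noteq> \<infinity>"
    using obtain_finite_pos emeasure_UNIV_nonzero by auto
  have Ag: "(\<lambda>x. x + g) ` A \<in> sets borel"
    using right_translate_sets[OF A(1), of "- g"] by (simp add: image_right_eq_vimage)
  have "(\<lambda>x. x + (g + h)) ` A = (\<lambda>x. x + h) ` ((\<lambda>x. x + g) ` A)"
    by (simp add: image_image add.assoc)
  then have "ennreal (modular_function m (g + h)) * emeasure m A
      = ennreal (modular_function m h) * (ennreal (modular_function m g) * emeasure m A)"
    using emeasure_right_translate[OF A(1)] emeasure_right_translate[OF Ag] by metis
  also have "\<dots> = ennreal (modular_function m g * modular_function m h) * emeasure m A"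
    using modular_function_pos[of g] modular_function_pos[of h] by (simp add: ennreal_mult ac_simps)
  finally have "ennreal (modular_function m (g + h)) = ennreal (modular_function m g * modular_function m h)"
    using A by (auto simp: mult.commute[of _ "emeasure m A"] ennreal_mult_cancel_left)
  then show ?thesis
    using modular_function_pos[of g] modular_function_pos[of h] modular_function_pos[of "g + h"]
    by (simp add: less_imp_le)
qed

text \<open>For a fixed test set \<open>A\<close>, the value at \<open>g\<close> is a quotient whose
  numerator is the measure of the section at \<open>g\<close> of a measurable subset of the product,
  hence measurable in \<open>g\<close>.\<close>

lemma measurable_modular_function: "modular_function m \<in> borel_measurable borel"
proof -
  obtain A where A [measurable]: "A \<in> sets borel" and A': "emeasure m A \<noteq> 0" "emeasure m A \<noteq> \<infinity>"
    using obtain_finite_pos emeasure_UNIV_nonzero by auto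
  have eq: "modular_function m g = enn2real (emeasure m ((\<lambda>x. x + g) ` A)) / enn2real (emeasure m A)" for g
    using A' modular_function_pos[of g]
    by (simp add: emeasure_right_translate enn2real_mult enn2real_eq_0_iff)
  define Q where "Q = {p \<in> space (borel \<Otimes>\<^sub>M m). snd p + - fst p \<in> A}"
  have "Q \<in> sets (borel \<Otimes>\<^sub>M m)"
    unfolding Q_def by measurable
  then have "(\<lambda>g. emeasure m (Pair g -` Q)) \<in> borel_measurable borel"
    by (rule measurable_emeasure_Pair)
  moreover have "Pair g -` Q = (\<lambda>x. x + g) ` A" for g
    unfolding image_right_eq_vimage by (auto simp: Q_def space_pair_measure)
  ultimately have [measurable]: "(\<lambda>g. emeasure m ((\<lambda>x. x + g) ` A)) \<in> borel_measurable borel"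
    by simp
  show ?thesis unfolding eq by measurable
qed

text \<open>Fubini for the pairs \<open>(x, r)\<close> with \<open>\<phi> x + r \<in> N\<close>:
  translation invariance of Lebesgue measure makes every section at \<open>x\<close> null, so the
  section at some \<open>r\<close> is null. Writing \<open>r = \<phi> g\<close> by surjectivity,
  that section is a left translate of the preimage of \<open>N\<close>.\<close>

lemma null_hom_vimage:
  fixes \<phi> :: "'a \<Rightarrow> real"
  assumes [measurable]: "\<phi> \<in> borel_measurable borel" and add: "\<And>x y. \<phi> (x + y) = \<phi> x + \<phi> y"
    and "surj \<phi>" and N: "N \<in> null_sets lborel"
  shows "\<phi> -` N \<in> null_sets m"
proof -
  interpret P: pair_sigma_finite m lborel ..
  have [measurable]: "N \<in> sets borel" using N by (auto simp: null_sets_def)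
  have "AE r in lborel. \<phi> x + r \<notin> N" for x
  proof -
    have "AE r in distr lborel borel ((+) (\<phi> x)). r \<notin> N"
      unfolding lborel_distr_plus by (rule AE_not_in[OF N])
    then show ?thesis by (subst (asm) AE_distr_iff) auto
  qed
  then have "AE x in m. AE r in lborel. \<phi> x + r \<notin> N" by simp
  then have "AE r in lborel. AE x in m. \<phi> x + r \<notin> N"
    by (subst (asm) P.AE_commute) measurable
  moreover have "ae_filter (lborel :: real measure) \<noteq> bot"
    by (simp add: ae_filter_eq_bot_iff)
  ultimately obtain r where r: "AE x in m. \<phi> x + r \<notin> N"
    using eventually_happens' by blast
  obtain g where g: "\<phi> g = r" using \<open>surj \<phi>\<close> by (metis surjD)
  have "{x. \<phi> x + r \<in> N} \<in> null_sets m"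
    using r by (subst (asm) AE_iff_null) (simp_all, measurable)
  also have "{x. \<phi> x + r \<in> N} = (\<lambda>x. g + x) -` (\<phi> -` N)"
    by (auto simp: add g add.commute)
  finally show ?thesis
    using measurable_sets_borel[of \<phi> borel N] by (auto simp: null_sets_def emeasure_left_translate)
qed

end

text \<open>By Lindelof, countably many open sets contained in compact sets cover the group.\<close>

lemma left_haar_measure_sigma_finite:
  fixes m :: "'a::{topological_group_add, t2_space, second_countable_topology} measure"
  assumes "locally_compact_space (euclidean :: 'a topology)" and haar: "left_haar_measure m"
  shows "sigma_finite_left_haar m"
proof -
  have s: "sets m = sets borel" using haar by (simp add: left_haar_measure_def)
  then have sp: "space m = UNIV" using sets_eq_imp_space_eq by fastforce
  have "\<exists>U K. open U \<and> compact K \<and> x \<in> U \<and> U \<subseteq> K" for x :: 'a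
    using assms(1) by (simp add: locally_compact_space_def)
  then obtain U K where UK: "\<And>x::'a. open (U x) \<and> compact (K x) \<and> x \<in> U x \<and> U x \<subseteq> K x"
    by metis
  obtain F where F: "F \<subseteq> range U" "countable F" "\<Union>F = \<Union>(range U)"
    using Lindelof[of "range U"] UK by blast
  have "sigma_finite_measure m"
  proof
    have "emeasure m V \<noteq> \<infinity>" if "V \<in> F" for V
    proof -
      obtain x where "V = U x" using \<open>V \<in> F\<close> F(1) by blast
      then have "emeasure m V \<le> emeasure m (K x)"
        using UK[of x] by (intro emeasure_mono) (auto simp: s compact_imp_closed)
      also have "\<dots> < \<infinity>" using haar UK[of x] by (simp add: left_haar_measure_def)
      finally show ?thesis by simp
    qed
    moreover have "F \<subseteq> sets m" using F(1) UK by (auto simp: s)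
    moreover have "\<Union>F = space m" using F(3) UK sp by auto
    ultimately show "\<exists>A. countable A \<and> A \<subseteq> sets m \<and> \<Union>A = space m \<and> (\<forall>a\<in>A. emeasure m a \<noteq> \<infinity>)"
      using F(2) by blast
  qed
  then show ?thesis
    using haar by (simp add: sigma_finite_left_haar_def sigma_finite_left_haar_axioms_def)
qed

section \<open>Neighbourhoods of the zeros of a sine wave\<close>

text \<open>The zeros of \<open>sin (2 * pi * (k * x + s))\<close> are the points where
  \<open>2 * (k * x + s)\<close> is an integer; the band is a closed neighbourhood of them.\<close>

definition band :: "real \<Rightarrow> real \<Rightarrow> real \<Rightarrow> real set" where
  "band k s e = {x. \<exists>j::int. \<bar>2 * (k * x + s) - j\<bar> \<le> e}"

lemma band_sets [measurable]: "band k s e \<in> sets borel"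
proof -
  have "band k s e = (\<Union>j::int. {x. \<bar>2 * (k * x + s) - j\<bar> \<le> e})"
    by (auto simp: band_def)
  also have "\<dots> \<in> sets borel" by measurable
  finally show ?thesis .
qed

text \<open>The number of intervals meeting \<open>{-M..M}\<close> grows linearly in
  \<open>k\<close>, while each has length \<open>e / k\<close>; so the bound does not depend on
  \<open>k\<close>.\<close>

lemma emeasure_band_le:
  assumes "1 \<le> k" "0 \<le> s" "s \<le> 1" "0 \<le> e" "e \<le> 1" "0 \<le> M"
  shows "emeasure lborel (band k s e \<inter> {-M..M}) \<le> ennreal ((4 * M + 9) * e)"
proof -
  \<comment> \<open>If the \<open>j\<close>-th interval meets \<open>{-M..M}\<close>, then
    \<open>\<bar>j\<bar>\<close> is at most \<open>2 * k * M + 2 * s + e\<close>, hence at most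
    \<open>2 * k * M + 3\<close>.\<close>
  define J where "J = \<lceil>2 * k * M + 3\<rceil>"
  define I where "I = (\<lambda>j::int. {(j - 2 * s - e) / (2 * k) .. (j - 2 * s + e) / (2 * k)})"
  have J: "2 * k * M + 3 \<le> J" "J \<le> 2 * k * M + 4" "0 \<le> J"
  proof -
    show "2 * k * M + 3 \<le> J" "J \<le> 2 * k * M + 4" unfolding J_def by linarith+
    have "0 \<le> 2 * k * M" using assms by simp
    then show "0 \<le> J" unfolding J_def by linarith
  qed
  have sub: "band k s e \<inter> {-M..M} \<subseteq> (\<Union>j\<in>{-J..J}. I j)"
  proof
    fix x assume "x \<in> band k s e \<inter> {-M..M}"
    then obtain j :: int where j: "\<bar>2 * (k * x + s) - j\<bar> \<le> e" and x: "\<bar>x\<bar> \<le> M"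
      by (auto simp: band_def)
    have "\<bar>k * x\<bar> \<le> k * M" using x assms by (simp add: abs_mult mult_left_mono)
    moreover have "2 * (k * M) + 3 \<le> J" using J(1) by (simp add: mult.assoc)
    ultimately have "real_of_int j \<le> J \<and> - J \<le> real_of_int j"
      using j assms(2-5) unfolding abs_le_iff by (simp add: algebra_simps)
    then have "j \<in> {-J..J}" by auto
    moreover have "x \<in> I j"
      using j assms(1) by (auto simp: I_def field_simps abs_le_iff)
    ultimately show "x \<in> (\<Union>j\<in>{-J..J}. I j)" by blast
  qed
  have Ij: "emeasure lborel (I j) = ennreal (e / k)" for j
    using assms by (simp add: I_def divide_right_mono field_simps)
  have "emeasure lborel (band k s e \<inter> {-M..M}) \<le> emeasure lborel (\<Union>j\<in>{-J..J}. I j)"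
    by (rule emeasure_mono[OF sub]) (auto simp: I_def)
  also have "\<dots> \<le> (\<Sum>j\<in>{-J..J}. emeasure lborel (I j))"
    by (rule emeasure_subadditive_finite) (auto simp: I_def)
  also have "\<dots> = ennreal (\<Sum>j\<in>{-J..J}. e / k)"
    unfolding Ij using assms by (intro sum_ennreal) simp
  also have "\<dots> \<le> ennreal ((4 * M + 9) * e)"
  proof (rule ennreal_leI)
    have "(\<Sum>j\<in>{-J..J}. e / k) = (2 * J + 1) * (e / k)" using J(3) by simp
    also have "\<dots> \<le> (4 * k * M + 9 * k) * (e / k)"
      using J assms by (intro mult_right_mono) auto
    also have "\<dots> = (4 * M + 9) * e" using assms by (simp add: field_simps)
    finally show "(\<Sum>j\<in>{-J..J}. e / k) \<le> (4 * M + 9) * e" .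
  qed
  finally show ?thesis .
qed

text \<open>Borel-Cantelli on each interval \<open>{- real M .. real M}\<close> separately, because
  a whole band of positive width has infinite Lebesgue measure.\<close>

lemma AE_eventually_not_in_band:
  fixes k s e :: "nat \<Rightarrow> real"
  assumes "\<And>n. 1 \<le> k n" "\<And>n. 0 \<le> s n" "\<And>n. s n \<le> 1" "\<And>n. 0 \<le> e n" "\<And>n. e n \<le> 1" "summable e"
  shows "AE x in lborel. \<forall>\<^sub>F n in sequentially. x \<notin> band (k n) (s n) (e n)"
proof -
  let ?B = "\<lambda>M n. band (k n) (s n) (e n) \<inter> {- real M .. real M}"
  have "AE x in lborel. \<forall>\<^sub>F n in sequentially. x \<in> space lborel - ?B M n" for M :: nat
  proof (rule borel_cantelli_AE1)
    have le: "emeasure lborel (?B M n) \<le> ennreal ((4 * M + 9) * e n)" for n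
      using emeasure_band_le[of "k n" "s n" "e n" "real M"] assms by simp
    show fin: "emeasure lborel (?B M n) < \<infinity>" for n
      using le_less_trans[OF le] by simp
    have "measure lborel (?B M n) \<le> (4 * M + 9) * e n" for n
      using le[of n] assms(4) unfolding measure_def by (intro enn2real_leI) auto
    then show "summable (\<lambda>n. measure lborel (?B M n))"
      by (intro summable_comparison_test'[OF summable_mult[OF assms(6), of "4 * M + 9"]]) simp
  qed auto
  then have "AE x in lborel. \<forall>M::nat. \<forall>\<^sub>F n in sequentially. x \<in> space lborel - ?B M n"
    by (simp add: AE_all_countable)
  then show ?thesis
  proof eventually_elim
    case (elim x)
    obtain M :: nat where M: "\<bar>x\<bar> \<le> M" using real_arch_simple by blast
    have "\<forall>\<^sub>F n in sequentially. x \<in> space lborel - ?B M n" using elim by blast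
    then show ?case by (rule eventually_mono) (use M in auto)
  qed
qed

text \<open>Shifting the second phase by \<open>p\<close> full periods brings it within
  \<open>e / 2\<close> of the first. The sign change then forces a zero between the two by the
  intermediate value theorem.\<close>

lemma sin_pos_sign_change_in_band:
  fixes p :: int
  assumes "(0 < sin (2 * pi * (k * x + s))) \<noteq> (0 < sin (2 * pi * (k * y + s)))"
    and "\<bar>k * (x - y) - p\<bar> \<le> e / 2"
  shows "x \<in> band k s e"
proof -
  define u v where "u = k * x + s" and "v = k * y + s + p"
  have "sin (2 * pi * v) = sin (2 * pi * (k * y + s) + 2 * pi * of_int p)"
    by (simp add: v_def algebra_simps)
  also have "\<dots> = sin (2 * pi * (k * y + s))"
    by (simp add: sin_add)
  finally have ne: "(0 < sin (2 * pi * u)) \<noteq> (0 < sin (2 * pi * v))"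
    using assms(1) by (simp add: u_def)
  have uv: "\<bar>u - v\<bar> \<le> e / 2" using assms(2) by (simp add: u_def v_def algebra_simps)
  have cont: "\<And>z. isCont (\<lambda>z. sin (2 * pi * z)) z" by (intro continuous_intros)
  have "\<exists>z. min u v \<le> z \<and> z \<le> max u v \<and> sin (2 * pi * z) = 0"
    using ne IVT[of "\<lambda>z. sin (2 * pi * z)" "min u v" 0 "max u v"]
      IVT2[of "\<lambda>z. sin (2 * pi * z)" "max u v" 0 "min u v"] cont
    by (cases "u \<le> v") (auto simp: min_def max_def not_less)
  then obtain z where z: "min u v \<le> z" "z \<le> max u v" "sin (2 * pi * z) = 0" by blast
  obtain j :: int where "2 * pi * z = of_int j * pi"
    using z(3) by (auto simp: sin_zero_iff_int2)
  then have "2 * z = j" by simp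
  then have "\<bar>2 * (k * x + s) - j\<bar> \<le> e"
    using z(1,2) uv unfolding u_def[symmetric] by (auto simp: min_def max_def split: if_splits)
  then show ?thesis by (auto simp: band_def)
qed

section \<open>Choice of phases and frequencies\<close>

text \<open>Moving the phase by half a period replaces the set by its complement up to a null set,
  so the probabilities at phases 0 and 1/2 add up to 1. The probability is continuous in the phase,
  hence equals 1/2 somewhere between.\<close>

lemma (in prob_space) exists_balanced_phase:
  assumes [measurable]: "f \<in> borel_measurable M"
    and diffuse: "\<And>c. AE x in M. f x \<noteq> (c::real)"
  shows "\<exists>s. 0 \<le> s \<and> s \<le> 1/2 \<and> prob {x\<in>space M. 0 < sin (2 * pi * (f x + s))} = 1/2"
proof -
  define A where "A s = {x\<in>space M. 0 < sin (2 * pi * (f x + s))}" for s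
  have [measurable]: "A s \<in> sets M" for s unfolding A_def by measurable
  have nz: "AE x in M. sin (2 * pi * (f x + s)) \<noteq> 0" for s
  proof -
    have "AE x in M. \<forall>j::int. f x \<noteq> j / 2 - s"
      unfolding AE_all_countable using diffuse by blast
    then show ?thesis
    proof eventually_elim
      case (elim x)
      show ?case
      proof
        assume "sin (2 * pi * (f x + s)) = 0"
        then obtain j :: int where "2 * pi * (f x + s) = of_int j * pi"
          by (auto simp: sin_zero_iff_int2)
        then have "2 * (f x + s) = j" by simp
        then have "f x = j / 2 - s" by simp
        with elim show False by blast
      qed
    qed
  qed
  have cont: "continuous_on UNIV (\<lambda>s. prob (A s))"
  proof (rule continuous_on_sequentiallyI)
    fix u :: "nat \<Rightarrow> real" and s assume u: "u \<longlonglongrightarrow> s"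
    \<comment> \<open>At a point where the sine at phase \<open>s\<close> is nonzero, its sign is
      eventually the same along \<open>u\<close>, so the indicators converge almost
      everywhere.\<close>
    have "(\<lambda>n. integral\<^sup>L M (indicator (A (u n)) :: _ \<Rightarrow> real)) \<longlonglongrightarrow> integral\<^sup>L M (indicator (A s))"
    proof (rule integral_dominated_convergence[where w = "\<lambda>_. 1"])
      show "AE x in M. (\<lambda>n. indicator (A (u n)) x) \<longlonglongrightarrow> (indicator (A s) x :: real)"
        using nz[of s] AE_space
      proof eventually_elim
        case (elim x)
        have lim: "(\<lambda>n. sin (2 * pi * (f x + u n))) \<longlonglongrightarrow> sin (2 * pi * (f x + s))"
          by (intro tendsto_intros u)
        have "\<forall>\<^sub>F n in sequentially. (x \<in> A (u n)) = (x \<in> A s)"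
        proof (cases "0 < sin (2 * pi * (f x + s))")
          case True
          show ?thesis
            using order_tendstoD(1)[OF lim True] by eventually_elim (use True elim in \<open>auto simp: A_def\<close>)
        next
          case False
          then have "sin (2 * pi * (f x + s)) < 0" using elim by simp
          from order_tendstoD(2)[OF lim this] show ?thesis
            by eventually_elim (use False elim in \<open>auto simp: A_def\<close>)
        qed
        then show ?case
          by (intro tendsto_eventually) (auto elim!: eventually_mono simp: indicator_def)
      qed
    qed (auto simp: indicator_def)
    then show "(\<lambda>n. prob (A (u n))) \<longlonglongrightarrow> prob (A s)" by simp
  qed
  have "prob (A (1/2)) = prob (space M - A 0)"
  proof (rule finite_measure_eq_AE)
    show "AE x in M. (x \<in> A (1/2)) = (x \<in> space M - A 0)"
      using nz[of 0] AE_space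
    proof eventually_elim
      case (elim x)
      have "sin (2 * pi * (f x + 1/2)) = - sin (2 * pi * f x)"
        by (simp add: distrib_left)
      with elim show ?case by (auto simp: A_def)
    qed
  qed auto
  then have half: "prob (A (1/2)) = 1 - prob (A 0)" by (simp add: prob_compl)
  have c: "continuous_on {0..1/2} (\<lambda>s. prob (A s))" using cont continuous_on_subset by blast
  have "\<exists>s. 0 \<le> s \<and> s \<le> 1/2 \<and> prob (A s) = 1/2"
  proof (cases "prob (A 0) \<le> 1/2")
    case True
    then show ?thesis using half c IVT'[of "\<lambda>s. prob (A s)" 0 "1/2" "1/2"] by auto
  next
    case False
    then show ?thesis using half c IVT2'[of "\<lambda>s. prob (A s)" "1/2" "1/2" 0] by auto
  qed
  then show ?thesis by (simp add: A_def)
qed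

text \<open>The \<open>n\<close>-th frequency comes from Dirichlet's theorem for the first
  \<open>n\<close> terms of an enumeration, so each fixed element is handled from some index
  on.\<close>

lemma countable_simultaneous_approx:
  fixes L :: "real set"
  assumes "countable L"
  shows "\<exists>k :: nat \<Rightarrow> real. (\<forall>n. 1 \<le> k n) \<and>
    (\<forall>l\<in>L. \<forall>\<^sub>F n in sequentially. \<exists>p::int. \<bar>k n * l - p\<bar> \<le> (1/2) ^ n / 2)"
proof -
  \<comment> \<open>The enumeration may repeat elements; for empty \<open>L\<close> its values are
    arbitrary, but then the claim on members of \<open>L\<close> is vacuous.\<close>
  define t where "t = from_nat_into L"
  have "\<exists>q::int. 1 \<le> q \<and> (\<forall>i<n. \<exists>p::int. \<bar>real_of_int q * t i - p\<bar> \<le> (1/2) ^ n / 2)" for n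
  proof -
    \<comment> \<open>The parameter \<open>2 ^ Suc n\<close> gives the error
      \<open>(1/2) ^ n / 2\<close>, half of the band parameter \<open>(1/2) ^ n\<close> used
      later.\<close>
    obtain q p where "0 < q" and qp: "\<And>i. i < n \<Longrightarrow> \<bar>of_int q * t i - of_int (p i)\<bar> < 1 / real (2 ^ Suc n)"
      by (rule Dirichlet_approx_simult[of "2 ^ Suc n" n t]) (simp, metis)
    have "\<bar>real_of_int q * t i - p i\<bar> \<le> (1/2) ^ n / 2" if "i < n" for i
      using qp[OF that] by (simp add: power_one_over)
    with \<open>0 < q\<close> show ?thesis by (intro exI[of _ q]) auto
  qed
  then obtain q :: "nat \<Rightarrow> int" where q: "\<And>n. 1 \<le> q n"
    "\<And>n i. i < n \<Longrightarrow> \<exists>p::int. \<bar>real_of_int (q n) * t i - p\<bar> \<le> (1/2) ^ n / 2"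
    by metis
  show ?thesis
  proof (intro exI[of _ "\<lambda>n. real_of_int (q n)"] conjI allI ballI)
    show "1 \<le> real_of_int (q n)" for n using q(1)[of n] by simp
    fix l assume "l \<in> L"
    then obtain i where i: "t i = l" using from_nat_into_surj[OF assms] by (auto simp: t_def)
    show "\<forall>\<^sub>F n in sequentially. \<exists>p::int. \<bar>real_of_int (q n) * l - p\<bar> \<le> (1/2) ^ n / 2"
      using eventually_gt_at_top[of i] by eventually_elim (use q(2) i in blast)
  qed
qed

section \<open>Pointwise criteria for almost invariance\<close>

lemma (in finite_measure) measure_tendsto_0_AE:
  assumes [measurable]: "\<And>n. B n \<in> sets M"
    and "AE x in M. \<forall>\<^sub>F n in sequentially. x \<notin> B n"
  shows "(\<lambda>n. measure M (B n)) \<longlonglongrightarrow> 0"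
proof -
  have "(\<lambda>n. integral\<^sup>L M (indicator (B n) :: _ \<Rightarrow> real)) \<longlonglongrightarrow> integral\<^sup>L M (\<lambda>_. 0)"
  proof (rule integral_dominated_convergence[where w = "\<lambda>_. 1"])
    show "AE x in M. (\<lambda>n. indicator (B n) x) \<longlonglongrightarrow> (0 :: real)"
      using assms(2)
      by eventually_elim (auto intro!: tendsto_eventually elim!: eventually_mono)
  qed (auto simp: indicator_def)
  then show ?thesis by simp
qed

lemma full_group_AE:
  assumes "g \<in> full_group M R"
  shows "AE x in M. \<exists>y\<in>space M. x = g y \<and> (x, y) \<in> R"
proof -
  have g: "bij_betw g (space M) (space M)" "\<And>A. A \<in> sets M \<Longrightarrow> g ` A \<in> null_sets M \<longleftrightarrow> A \<in> null_sets M"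
    and R: "AE x in M. (g x, x) \<in> R"
    using assms by (auto simp: full_group_def)
  obtain N where N: "{x\<in>space M. (g x, x) \<notin> R} \<subseteq> N" "N \<in> null_sets M"
    using R unfolding eventually_ae_filter by blast
  have "g ` N \<in> null_sets M" using N(2) g(2)[OF null_setsD2[OF N(2)]] by blast
  then show ?thesis
  proof (rule AE_I')
    show "{x\<in>space M. \<not> (\<exists>y\<in>space M. x = g y \<and> (x, y) \<in> R)} \<subseteq> g ` N"
    proof
      fix x assume x: "x \<in> {x\<in>space M. \<not> (\<exists>y\<in>space M. x = g y \<and> (x, y) \<in> R)}"
      then have "x \<in> g ` space M" using g(1) by (simp add: bij_betw_def)
      then obtain y where y: "y \<in> space M" "x = g y" by blast
      with x have "(g y, y) \<notin> R" by blast
      with y N(1) show "x \<in> g ` N" by blast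
    qed
  qed
qed

lemma full_group_image_sets:
  assumes "g \<in> full_group M R" and A: "A \<in> sets M"
  shows "g ` A \<in> sets M"
proof -
  have g: "bij_betw g (space M) (space M)" "the_inv_into (space M) g \<in> measurable M M"
    using assms by (auto simp: full_group_def)
  have "g ` A = the_inv_into (space M) g -` A \<inter> space M"
    using g(1) sets.sets_into_space[OF A]
    by (auto simp: bij_betw_def the_inv_into_f_f subset_iff image_iff)
      (metis f_the_inv_into_f)
  then show ?thesis using measurable_sets[OF g(2) A] by simp
qed

section \<open>The non-trivial almost invariant sequence\<close>

theorem theoremA:
  fixes m :: "'a::{topological_group_add, t2_space, second_countable_topology} measure"
    and \<Gamma> :: "'a set"
  assumes "locally_compact_space (euclidean :: 'a topology)"
    and "left_haar_measure m"
    and "range (modular_function m) = {0<..}"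
    and "add_subgroup \<Gamma>" and "countable \<Gamma>" and "closure \<Gamma> = UNIV"
  shows "\<not> strongly_ergodic_action \<Gamma> (\<lambda>g x. g + x) m"
proof
  interpret sigma_finite_left_haar m
    using assms(1,2) by (rule left_haar_measure_sigma_finite)
  let ?R = "orbit_rel \<Gamma> (\<lambda>g x. g + x)"
  assume "strongly_ergodic_action \<Gamma> (\<lambda>g x. g + x) m"
  then obtain \<mu> where "prob_space \<mu>" and equiv: "equivalent_measures \<mu> m"
    and se: "strongly_ergodic \<mu> ?R"
    unfolding strongly_ergodic_action_def by blast
  interpret \<mu>: prob_space \<mu> by fact
  have sets_\<mu> [measurable_cong]: "sets \<mu> = sets borel"
    using equiv by (simp add: equivalent_measures_def)
  then have space_\<mu>: "space \<mu> = UNIV"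
    using sets_eq_imp_space_eq by fastforce
  have null_\<mu>: "N \<in> null_sets \<mu>" if "N \<in> null_sets m" for N
    using equiv that by (auto simp: equivalent_measures_def absolutely_continuous_def)
  define \<phi> where "\<phi> x = ln (modular_function m x)" for x
  note measurable_modular_function [measurable]
  have \<phi>_meas [measurable]: "\<phi> \<in> borel_measurable borel"
    unfolding \<phi>_def by measurable
  have \<phi>_add: "\<phi> (x + y) = \<phi> x + \<phi> y" for x y
    using modular_function_pos[of x] modular_function_pos[of y]
    by (simp add: \<phi>_def modular_function_add ln_mult)
  have "surj \<phi>"
  proof (rule surjI)
    fix r :: real
    have "exp r \<in> range (modular_function m)" unfolding assms(3) by simp
    then show "\<phi> (SOME x. modular_function m x = exp r) = r"
      unfolding \<phi>_def by (metis (mono_tags, lifting) imageE ln_exp someI)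
  qed
  \<comment> \<open>Almost sure statements on the real line pull back along \<open>\<phi>\<close>: a
    Lebesgue null set has an \<open>m\<close>-null preimage, which is \<open>\<mu>\<close>-null by
    equivalence.\<close>
  have AE_\<phi>: "AE x in \<mu>. P (\<phi> x)" if P: "AE r in lborel. P r" for P
  proof -
    obtain N where N: "\<And>r. r \<in> space lborel - N \<Longrightarrow> P r" "N \<in> null_sets lborel"
      using AE_E3[OF P] by blast
    have "\<phi> -` N \<in> null_sets \<mu>"
      using null_hom_vimage[OF \<phi>_meas \<phi>_add \<open>surj \<phi>\<close> N(2)] by (rule null_\<mu>)
    then show ?thesis by (rule AE_I') (use N(1) in \<open>auto simp: vimage_def\<close>)
  qed
  obtain k :: "nat \<Rightarrow> real" where k: "\<And>n. 1 \<le> k n"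
    and approx: "\<And>l. l \<in> \<phi> ` \<Gamma> \<Longrightarrow>
      \<forall>\<^sub>F n in sequentially. \<exists>p::int. \<bar>k n * l - p\<bar> \<le> (1/2) ^ n / 2"
    using countable_simultaneous_approx[OF countable_image[OF assms(5)]] by blast
  have "AE x in \<mu>. k n * \<phi> x \<noteq> c" for n c
  proof -
    have "AE r in lborel. r \<noteq> c / k n" by (rule AE_lborel_singleton)
    from AE_\<phi>[OF this] show ?thesis
      by eventually_elim (use k[of n] in \<open>auto simp: field_simps\<close>)
  qed
  then have "\<forall>n. \<exists>s. 0 \<le> s \<and> s \<le> 1/2 \<and>
      \<mu>.prob {x\<in>space \<mu>. 0 < sin (2 * pi * (k n * \<phi> x + s))} = 1/2"
    by (intro allI \<mu>.exists_balanced_phase) measurable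
  from choice[OF this] obtain s where s: "\<And>n. 0 \<le> s n" "\<And>n. s n \<le> 1/2"
    and half: "\<And>n. \<mu>.prob {x\<in>space \<mu>. 0 < sin (2 * pi * (k n * \<phi> x + s n))} = 1/2"
    by blast
  define A where "A n = {x\<in>space \<mu>. 0 < sin (2 * pi * (k n * \<phi> x + s n))}" for n
  have A_sets [measurable]: "A n \<in> sets \<mu>" for n
    unfolding A_def by measurable
  \<comment> \<open>The widths \<open>(1/2) ^ n\<close> are summable and twice the error in
    \<open>approx\<close>, as \<open>sin_pos_sign_change_in_band\<close> demands.\<close>
  have "AE r in lborel. \<forall>\<^sub>F n in sequentially. r \<notin> band (k n) (s n) ((1/2) ^ n)"
  proof (rule AE_eventually_not_in_band)
    show "s n \<le> 1" for n using s(2)[of n] by simp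
    show "(1/2 :: real) ^ n \<le> 1" for n by (simp add: power_le_one)
  qed (use k s in auto)
  then have bands: "AE x in \<mu>. \<forall>\<^sub>F n in sequentially. \<phi> x \<notin> band (k n) (s n) ((1/2) ^ n)"
    by (rule AE_\<phi>)
  have "almost_invariant_seq \<mu> ?R A"
    unfolding almost_invariant_seq_def
  proof (intro conjI ballI allI A_sets)
    fix g assume g: "g \<in> full_group \<mu> ?R"
    have inj: "inj_on g (space \<mu>)" using g by (auto simp: full_group_def bij_betw_def)
    show "(\<lambda>n. \<mu>.prob (sym_diff (A n) (g ` A n))) \<longlonglongrightarrow> 0"
    proof (rule \<mu>.measure_tendsto_0_AE)
      show "sym_diff (A n) (g ` A n) \<in> sets \<mu>" for n
        using full_group_image_sets[OF g A_sets] A_sets by blast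
      show "AE x in \<mu>. \<forall>\<^sub>F n in sequentially. x \<notin> sym_diff (A n) (g ` A n)"
        using bands full_group_AE[OF g]
      proof eventually_elim
        case (elim x)
        \<comment> \<open>The element \<open>\<gamma>\<close> depends on \<open>x\<close> but not on
          \<open>n\<close>, so for fixed \<open>x\<close> the approximation is used for a single
          \<open>\<gamma>\<close>; no uniformity over the full group element \<open>g\<close> is
          required.\<close>
        then obtain y \<gamma> where y: "y \<in> space \<mu>" "x = g y" and \<gamma>: "\<gamma> \<in> \<Gamma>" "x = \<gamma> + y"
          by (auto simp: orbit_rel_def)
        have \<phi>\<gamma>: "\<phi> x - \<phi> y = \<phi> \<gamma>" by (simp add: \<gamma>(2) \<phi>_add)
        have mem: "x \<in> g ` A n \<longleftrightarrow> y \<in> A n" for n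
          unfolding y(2) using inj y(1) by (intro inj_on_image_mem_iff) (auto simp: A_def)
        show ?case
          using elim(1) approx[OF imageI[OF \<gamma>(1)]]
        proof eventually_elim
          case (elim n)
          then obtain p :: int where "\<bar>k n * (\<phi> x - \<phi> y) - p\<bar> \<le> (1/2) ^ n / 2"
            unfolding \<phi>\<gamma> by blast
          then have "x \<in> A n \<longleftrightarrow> y \<in> A n"
            using sin_pos_sign_change_in_band[of "k n" "\<phi> x" "s n" "\<phi> y" p "(1/2) ^ n"] elim(1)
            by (auto simp: A_def space_\<mu>)
          then show ?case using mem by blast
        qed
      qed
    qed
  qed
  with se have "trivial_seq \<mu> A" by (simp add: strongly_ergodic_def)
  \<comment> \<open>Every \<open>A n\<close> has measure 1/2, so the products in
    \<open>trivial_seq\<close> are constantly 1/4.\<close>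
  then have "(\<lambda>n::nat. 1/4 :: real) \<longlonglongrightarrow> 0"
    by (simp add: trivial_seq_def A_def half)
  then show False by (simp add: LIMSEQ_const_iff)
qed

end
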